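(* Let $\varphi:\mathbb R^n\to\mathbb R$ be directionally Lipschitz continuous at $\bar x$ in direction $u\in\mathbb R^n$. Then $$\partial^c\varphi(\bar x;u)=\mathrm{co}\limsup_{x\xrightarrow{u}\bar x}\partial^c\varphi(x),\qquad \partial^c(-\varphi)(\bar x;u)=-\partial^c\varphi(\bar x;u).$$
   Context: $\mathbb B$ is the open unit ball. For a direction $d$ and $\epsilon,\delta>0$: $\mathcal V_{\epsilon,\delta}(d):=\{z\in\epsilon\mathbb B : \big\|\,\|d\|z-\|z\|d\,\big\|\le\delta\|z\|\|d\|\}$. $\varphi$ is directionally Lipschitz continuous at $\bar x$ in direction $u$ if there are $L,\epsilon,\delta>0$ with $|\varphi(x)-\varphi(x')|\le L\|x-x'\|$ for all $x,x'\in\bar x+\mathcal V_{\epsilon,\delta}(u)$. Regular (Fréchet) subdifferential: $\widehat\partial\varphi(\bar x)=\{\xi:\varphi(x)\ge\varphi(\bar x)+\langle\xi,x-\bar x\rangle+o(\|x-\bar x\|)\}$. Directional limiting subdifferential: $\partial\varphi(\bar x;u)=\{\xi:\exists t_k\downarrow0,u^k\to u,\xi^k\to\xi\text{ with }\varphi(\bar x+t_ku^k)\to\varphi(\bar x),\ \xi^k\in\widehat\partial\varphi(\bar x+t_ku^k)\}$. Directional Clarke subdifferential: $\partial^c\varphi(\bar x;u):=\mathrm{co}\,\partial\varphi(\bar x;u)$ (convex hull). For a point $x$ near which $\varphi$ is Lipschitz, $\partial^c\varphi(x)=\partial^c\varphi(x;0)$ is the usual Clarke subdifferential (convex hull of the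 limiting subdifferential). For a set-valued map $\Phi$, $\limsup_{x\xrightarrow{u}\bar x}\Phi(x):=\{y:\exists t_k\downarrow0,\ d^k\to u,\ y^k\to y\text{ with }y^k\in\Phi(\bar x+t_kd^k)\}$. *)

theory Defs
  imports "HOL-Analysis.Analysis" "HOL-Library.Landau_Symbols"
begin

definition dir_nbhd :: "real \<Rightarrow> real \<Rightarrow> 'a::real_normed_vector \<Rightarrow> 'a set" where
  "dir_nbhd \<epsilon> \<delta> d =
     {z \<in> ball 0 \<epsilon>. norm (norm d *\<^sub>R z - norm z *\<^sub>R d) \<le> \<delta> * norm z * norm d}"

definition dir_lipschitz_at :: "('a::real_normed_vector \<Rightarrow> real) \<Rightarrow> 'a \<Rightarrow> 'a \<Rightarrow> bool" where
  "dir_lipschitz_at \<phi> xb u \<longleftrightarrow>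
     (\<exists>L>0. \<exists>\<epsilon>>0. \<exists>\<delta>>0.
        \<forall>x \<in> (+) xb ` dir_nbhd \<epsilon> \<delta> u. \<forall>x' \<in> (+) xb ` dir_nbhd \<epsilon> \<delta> u.
          \<bar>\<phi> x - \<phi> x'\<bar> \<le> L * norm (x - x'))"

definition regular_subdiff :: "('a::real_inner \<Rightarrow> real) \<Rightarrow> 'a \<Rightarrow> 'a set" where
  "regular_subdiff \<phi> xb =
     {\<xi>. \<exists>r \<in> o[at xb](\<lambda>x. norm (x - xb)).
            \<forall>\<^sub>F x in at xb. \<phi> x \<ge> \<phi> xb + \<xi> \<bullet> (x - xb) + r x}"

definition dir_limiting_subdiff :: "('a::real_inner \<Rightarrow> real) \<Rightarrow> 'a \<Rightarrow> 'a \<Rightarrow> 'a set" where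
  "dir_limiting_subdiff \<phi> xb u =
     {\<xi>. \<exists>(t::nat \<Rightarrow> real) uk \<xi>k.
            (\<forall>k. t k > 0) \<and> t \<longlonglongrightarrow> 0 \<and> uk \<longlonglongrightarrow> u \<and> \<xi>k \<longlonglongrightarrow> \<xi> \<and>
            (\<lambda>k. \<phi> (xb + t k *\<^sub>R uk k)) \<longlonglongrightarrow> \<phi> xb \<and>
            (\<forall>k. \<xi>k k \<in> regular_subdiff \<phi> (xb + t k *\<^sub>R uk k))}"

definition dir_clarke_subdiff :: "('a::real_inner \<Rightarrow> real) \<Rightarrow> 'a \<Rightarrow> 'a \<Rightarrow> 'a set" where
  "dir_clarke_subdiff \<phi> xb u = convex hull (dir_limiting_subdiff \<phi> xb u)"

text \<open>Direction 0 imposes no restriction, so \<open>dir_limiting_subdiff \<phi> x 0\<close> is the limiting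
  subdifferential. The following is the usual Clarke subdifferential only when \<open>\<phi>\<close> is Lipschitz
  near \<open>x\<close>; elsewhere it is still the convex hull of the limiting subdifferential.\<close>

definition clarke_subdiff :: "('a::real_inner \<Rightarrow> real) \<Rightarrow> 'a \<Rightarrow> 'a set" where
  "clarke_subdiff \<phi> x = dir_clarke_subdiff \<phi> x 0"

definition dir_limsup ::
  "('a::real_normed_vector \<Rightarrow> 'b::topological_space set) \<Rightarrow> 'a \<Rightarrow> 'a \<Rightarrow> 'b set" where
  "dir_limsup \<Phi> xb u =
     {y. \<exists>(t::nat \<Rightarrow> real) d yk.
            (\<forall>k. t k > 0) \<and> t \<longlonglongrightarrow> 0 \<and> d \<longlonglongrightarrow> u \<and> yk \<longlonglongrightarrow> y \<and>
            (\<forall>k. yk k \<in> \<Phi> (xb + t k *\<^sub>R d k))}"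

end

theory Submission imports Defs begin

text \<open>
  A point outside the compact convex set \<open>dir_clarke_subdiff \<phi> xb u\<close> is strictly separated from it by
  some \<open>a\<close>, and by compactness the separating inequality \<open>a \<bullet> \<xi> > b\<close> already holds for all regular
  subgradients at the points of an open truncated cone around \<open>xb + \<real>\<^sub>+ u\<close>. It passes to Clarke
  subgradients at these points, which gives the formula with the outer limit. For the symmetry
  under \<open>\<phi> \<mapsto> - \<phi>\<close>, a regular supergradient \<open>\<eta>\<close> with \<open>a \<bullet> \<eta> < b\<close> makes \<open>\<phi>\<close> grow with slope less
  than \<open>b\<close> along \<open>a\<close>, so a one-sided mean value argument yields a nearby regular subgradient with
  \<open>a \<bullet> \<xi> \<le> b\<close>. No almost everywhere differentiability is needed.
\<close>

section \<open>Regular subgradients: remainder estimates and the Lipschitz bound\<close>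

lemma regular_subdiffD:
  assumes "\<xi> \<in> regular_subdiff f x" "c > 0"
  shows "\<exists>r>0. \<forall>y. dist y x < r \<longrightarrow> f x + \<xi> \<bullet> (y - x) - c * norm (y - x) \<le> f y"
proof -
  obtain e where e: "e \<in> o[at x](\<lambda>y. norm (y - x))"
    and ge: "\<forall>\<^sub>F y in at x. f y \<ge> f x + \<xi> \<bullet> (y - x) + e y"
    using assms(1) by (auto simp: regular_subdiff_def)
  have "\<forall>\<^sub>F y in at x. f x + \<xi> \<bullet> (y - x) - c * norm (y - x) \<le> f y"
    using ge landau_o.smallD[OF e assms(2)] by eventually_elim auto
  then obtain r where "r > 0"
    "\<And>y. y \<noteq> x \<Longrightarrow> dist y x < r \<Longrightarrow> f x + \<xi> \<bullet> (y - x) - c * norm (y - x) \<le> f y"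
    by (auto simp: eventually_at)
  then show ?thesis
    by (metis add.right_neutral diff_self diff_zero inner_zero_right mult_zero_right norm_zero order_refl)
qed

text \<open>A quadratic remainder is of smaller order than \<open>norm (y - x)\<close>. Minimality
  of \<open>f\<close> plus a quadratic gives subgradients in exactly this form.\<close>

lemma regular_subdiffI_quadratic:
  assumes "\<forall>\<^sub>F y in nhds x. f x + \<xi> \<bullet> (y - x) - c * (norm (y - x))\<^sup>2 \<le> f y"
  shows "\<xi> \<in> regular_subdiff f x"
proof -
  have "((\<lambda>y. c * norm (y - x)) \<longlongrightarrow> c * norm (x - x)) (at x)"
    by (intro tendsto_intros)
  then have lim: "((\<lambda>y. c * norm (y - x)) \<longlongrightarrow> 0) (at x)" by simp
  have "(\<lambda>y. - c * (norm (y - x))\<^sup>2) \<in> o[at x](\<lambda>y. norm (y - x))"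
  proof (rule landau_o.smallI)
    fix e :: real assume "e > 0"
    have "\<forall>\<^sub>F y in at x. \<bar>c * norm (y - x)\<bar> < e"
      using tendstoD[OF lim \<open>e > 0\<close>] by simp
    then show "\<forall>\<^sub>F y in at x. norm (- c * (norm (y - x))\<^sup>2) \<le> e * norm (norm (y - x))"
    proof eventually_elim
      case (elim y)
      then have "\<bar>c * norm (y - x)\<bar> * norm (y - x) \<le> e * norm (y - x)"
        by (intro mult_right_mono) auto
      then show ?case by (simp add: abs_mult power2_eq_square mult.assoc)
    qed
  qed
  moreover have "\<forall>\<^sub>F y in at x. f x + \<xi> \<bullet> (y - x) + - c * (norm (y - x))\<^sup>2 \<le> f y"
    using assms by (auto simp: eventually_at_filter elim: eventually_mono)
  ultimately show ?thesis
    unfolding regular_subdiff_def by (intro CollectI bexI[where x = "\<lambda>y. - c * (norm (y - x))\<^sup>2"])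
qed

text \<open>Moving from \<open>x\<close> by \<open>t\<close> along \<open>\<xi>\<close> itself
  raises \<open>f\<close> by at least \<open>t * norm \<xi> * (norm \<xi> - c)\<close>, while the
  Lipschitz condition allows at most \<open>L * t * norm \<xi>\<close>; here \<open>c > 0\<close> is
  arbitrary.\<close>

lemma norm_regular_subdiff_le:
  assumes xi: "\<xi> \<in> regular_subdiff f x" and lip: "L-lipschitz_on U f" and "open U" "x \<in> U"
  shows "norm \<xi> \<le> L"
proof (cases "\<xi> = 0")
  case True
  then show ?thesis using lipschitz_on_nonneg[OF lip] by simp
next
  case False
  show ?thesis
  proof (rule field_le_epsilon)
    fix c :: real assume c: "c > 0"
    obtain r where r: "r > 0"
      "\<And>y. dist y x < r \<Longrightarrow> f x + \<xi> \<bullet> (y - x) - c * norm (y - x) \<le> f y"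
      using regular_subdiffD[OF xi c] by auto
    obtain q where q: "q > 0" "ball x q \<subseteq> U"
      using assms(3,4) by (auto simp: open_contains_ball)
    define t where "t = min r q / (2 * norm \<xi>)"
    have t: "t > 0" "t * norm \<xi> < r" "t * norm \<xi> < q"
      using r(1) q(1) False by (auto simp: t_def min_def)
    define y where "y = x + t *\<^sub>R \<xi>"
    have d: "dist y x = t * norm \<xi>" "norm (y - x) = t * norm \<xi>"
      using t by (auto simp: y_def dist_norm)
    have "y \<in> U" using q d t by (auto simp: dist_commute)
    then have "f y - f x \<le> L * (t * norm \<xi>)"
      using lipschitz_onD[OF lip \<open>y \<in> U\<close> \<open>x \<in> U\<close>] d by (auto simp: dist_real_def)
    moreover have "\<xi> \<bullet> (y - x) = t * norm \<xi> * norm \<xi>"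
      by (simp add: y_def power2_norm_eq_inner[symmetric] power2_eq_square)
    ultimately have "(t * norm \<xi>) * norm \<xi> \<le> (t * norm \<xi>) * (L + c)"
      using r(2)[of y] d t by (simp add: algebra_simps)
    then show "norm \<xi> \<le> L + c" using t False by simp
  qed
qed

section \<open>A one-sided mean value argument\<close>

text \<open>
  In the coordinates \<open>y = x + s v + w\<close> with \<open>w \<bottom> v\<close>, minimise \<open>f y - \<alpha> s + A s\<^sup>2 + K |w|\<^sup>2\<close> over the cylinder
  \<open>0 \<le> s \<le> t\<close>, \<open>|w| \<le> t\<close>. The slope condition puts the minimum strictly below the value at \<open>x\<close>, and
  large \<open>A\<close> and then \<open>K\<close> keep the minimiser off the boundary. Stationarity there gives a regular
  subgradient with \<open>v \<bullet> \<xi> = \<alpha> - 2 A s \<le> \<alpha>\<close>.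
\<close>

lemma regular_subdiff_below_slope_unit:
  fixes f :: "'a::euclidean_space \<Rightarrow> real"
  assumes lip: "L-lipschitz_on (ball x r) f" and "r > 0"
    and sup: "- \<eta> \<in> regular_subdiff (\<lambda>y. - f y) x"
    and v: "norm v = 1" and slope: "v \<bullet> \<eta> < \<alpha>"
  shows "\<exists>z\<in>ball x r. \<exists>\<xi>\<in>regular_subdiff f z. v \<bullet> \<xi> \<le> \<alpha>"
proof -
  \<comment> \<open>Half the slope gap: \<open>v \<bullet> \<eta> + c = \<alpha> - c\<close>, so
    after spending \<open>c\<close> on the remainder the slope is still \<open>c\<close> below
    \<open>\<alpha>\<close>.\<close>
  define c where "c = (\<alpha> - v \<bullet> \<eta>) / 2"
  have c: "c > 0" using slope by (simp add: c_def)
  have L: "L \<ge> 0" using lipschitz_on_nonneg[OF lip] .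
  obtain \<rho> where \<rho>: "\<rho> > 0"
    "\<And>y. dist y x < \<rho> \<Longrightarrow> - f x + (- \<eta>) \<bullet> (y - x) - c * norm (y - x) \<le> - f y"
    using regular_subdiffD[OF sup c] by auto
  \<comment> \<open>The cylinder then stays within \<open>2 * t < r\<close> of \<open>x\<close>, and
    the upper estimate from the supergradient holds at distances up to \<open>t\<close>.\<close>
  define t where "t = min \<rho> r / 3"
  have t: "t > 0" "t < \<rho>" "2 * t < r" using \<rho>(1) \<open>r > 0\<close> by (auto simp: t_def min_def)
  \<comment> \<open>With \<open>A * t = M\<close>, the term \<open>A * t\<^sup>2\<close> on the face
    \<open>s = t\<close> pays for the linear term and the Lipschitz loss along \<open>v\<close>,
    with a surplus of \<open>t\<close>.\<close>
  define M where "M = \<bar>\<alpha>\<bar> + L + 1"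
  have M: "M > 0" using L by (simp add: M_def)
  define A where "A = M / t"
  have A: "A > 0" "A * t = M" using t M by (auto simp: A_def)
  \<comment> \<open>Height of the test point \<open>y0\<close> on the axis: so small that the term
    \<open>A * \<tau>\<^sup>2\<close> costs at most half of the gain \<open>c * \<tau>\<close>. The
    other half is the guaranteed decrease \<open>m\<close>.\<close>
  define \<tau> where "\<tau> = c * t / (2 * (M + c))"
  have \<tau>: "\<tau> > 0" "\<tau> < t" "A * \<tau> \<le> c / 2"
  proof -
    have "M + c > 0" "c * t > 0" "M * t > 0" using c t M by auto
    then show "\<tau> > 0" "\<tau> < t" by (auto simp: \<tau>_def pos_divide_less_eq algebra_simps)
    have "A * \<tau> = c / 2 * (M / (M + c))" using t \<open>M + c > 0\<close> by (simp add: \<tau>_def A_def field_simps)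
    also have "\<dots> \<le> c / 2 * 1"
      using c M by (intro mult_left_mono) auto
    finally show "A * \<tau> \<le> c / 2" by simp
  qed
  define m where "m = c * \<tau> / 2"
  have m: "m > 0" using c \<tau> by (simp add: m_def)
  \<comment> \<open>The first three bounds exclude, in this order, a minimiser on the face
    \<open>s = 0\<close>, on the face \<open>s = t\<close> and on the lateral boundary.\<close>
  obtain K where K: "K > L\<^sup>2 / (4 * m)" "K > L\<^sup>2 / (4 * t)" "K > (2 * L + \<bar>\<alpha>\<bar>) / t" "K > 0"
  proof
    define K where "K = 1 + L\<^sup>2 / (4 * m) + L\<^sup>2 / (4 * t) + (2 * L + \<bar>\<alpha>\<bar>) / t"
    have "0 \<le> L\<^sup>2 / (4 * m)" "0 \<le> L\<^sup>2 / (4 * t)" "0 \<le> (2 * L + \<bar>\<alpha>\<bar>) / t"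
      using m t L by auto
    then show "K > L\<^sup>2 / (4 * m)" "K > L\<^sup>2 / (4 * t)" "K > (2 * L + \<bar>\<alpha>\<bar>) / t" "K > 0"
      unfolding K_def by linarith+
  qed
  \<comment> \<open>Completing the square: the loss of \<open>f\<close> transversally to
    \<open>v\<close> is compensated by the \<open>K\<close> term up to
    \<open>L\<^sup>2 / (4 * K)\<close>.\<close>
  have pen: "- L * p + K * p\<^sup>2 \<ge> - (L\<^sup>2 / (4 * K))" for p
  proof -
    have "0 \<le> (2 * K * p - L)\<^sup>2 / (4 * K)" using K(4) by simp
    also have "\<dots> = - L * p + K * p\<^sup>2 + L\<^sup>2 / (4 * K)"
      using K(4) by (simp add: field_simps power2_eq_square)
    finally show ?thesis by simp
  qed
  have small: "L\<^sup>2 / (4 * K) < m" "L\<^sup>2 / (4 * K) < t"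
    using K(1,2,4) m t by (simp_all add: field_simps)
  define s where "s y = v \<bullet> (y - x)" for y
  define w where "w y = y - x - s y *\<^sub>R v" for y
  define q where "q y = - \<alpha> * s y + A * (s y)\<^sup>2 + K * (norm (w y))\<^sup>2" for y
  define C where "C = {y. 0 \<le> s y \<and> s y \<le> t \<and> norm (w y) \<le> t}"
  define I where "I = {y. 0 < s y \<and> s y < t \<and> norm (w y) < t}"
  have conts: "continuous_on S s" "continuous_on S w" for S
    unfolding s_def w_def by (intro continuous_intros)+
  have nyx: "norm (y - x) \<le> \<bar>s y\<bar> + norm (w y)" for y
    using norm_triangle_ineq[of "s y *\<^sub>R v" "w y"] v by (simp add: w_def)
  have nyx2: "norm (y - x) \<le> s y + norm (w y)" if "y \<in> C" for y
    using nyx[of y] that by (auto simp: C_def)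
  have Cball: "C \<subseteq> ball x r"
  proof
    fix y assume "y \<in> C"
    then show "y \<in> ball x r" using nyx2[of y] t by (auto simp: C_def dist_norm norm_minus_commute)
  qed
  have "closed C"
    unfolding C_def
    by (intro closed_Collect_conj closed_Collect_le continuous_intros conts)
  moreover have "bounded C" using Cball bounded_ball bounded_subset by blast
  ultimately have "compact C" by (simp add: compact_eq_bounded_closed)
  have "open I"
    unfolding I_def
    by (intro open_Collect_conj open_Collect_less continuous_intros conts)
  have "I \<subseteq> C" by (auto simp: I_def C_def)
  define y0 where "y0 = x + \<tau> *\<^sub>R v"
  have vv: "v \<bullet> v = 1" using v by (simp add: norm_eq_sqrt_inner)
  have s0: "s y0 = \<tau>" "w y0 = 0" by (auto simp: y0_def s_def w_def vv)
  have "y0 \<in> C" using s0 \<tau> t by (auto simp: C_def)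
  have fx: "\<bar>f y - f x\<bar> \<le> L * norm (y - x)" if "y \<in> C" for y
    using lipschitz_onD[OF lip, of y x] that Cball \<open>r > 0\<close> by (auto simp: dist_norm)
  have contf: "continuous_on C (\<lambda>y. f y + q y)"
    unfolding q_def
    by (intro continuous_intros conts continuous_on_subset[OF _ Cball] lipschitz_on_continuous_on[OF lip])
  obtain z where z: "z \<in> C" "\<And>y. y \<in> C \<Longrightarrow> f z + q z \<le> f y + q y"
    using continuous_attains_inf[OF \<open>compact C\<close> _ contf] \<open>y0 \<in> C\<close> by auto
  have "f z + q z \<le> f x - m"
  proof -
    have "f y0 \<le> f x + \<tau> * (v \<bullet> \<eta>) + c * \<tau>"
      using \<rho>(2)[of y0] \<tau> t v by (auto simp: y0_def dist_norm inner_commute)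
    also have "\<dots> = f x + (\<alpha> - c) * \<tau>" by (simp add: c_def field_simps)
    finally have "f y0 \<le> f x + (\<alpha> - c) * \<tau>" .
    moreover have "q y0 \<le> - \<alpha> * \<tau> + c / 2 * \<tau>"
      using mult_right_mono[OF \<tau>(3), of \<tau>] \<tau>(1) s0 by (simp add: q_def power2_eq_square)
    ultimately have "f y0 + q y0 \<le> f x - m" by (simp add: m_def algebra_simps)
    then show ?thesis using z(2)[OF \<open>y0 \<in> C\<close>] by linarith
  qed
  note zlow = this
  have fz: "f x - L * norm (z - x) \<le> f z" using fx[OF z(1)] by auto
  have zC: "0 \<le> s z" "s z \<le> t" "norm (w z) \<le> t" using z(1) by (auto simp: C_def)
  have Lz: "L * norm (z - x) \<le> L * s z + L * norm (w z)"
    using mult_left_mono[OF nyx2[OF z(1)] L] by (simp add: algebra_simps)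
  have "s z \<noteq> 0"
  proof
    assume "s z = 0"
    then have "f z + q z \<ge> f x + (- L * norm (w z) + K * (norm (w z))\<^sup>2)"
      using fz Lz by (simp add: q_def)
    then show False using pen[of "norm (w z)"] small zlow by linarith
  qed
  moreover have "s z \<noteq> t"
  proof
    assume st: "s z = t"
    have "A * t\<^sup>2 = \<bar>\<alpha>\<bar> * t + L * t + t"
      using A(2) by (simp add: power2_eq_square M_def algebra_simps flip: mult.assoc)
    moreover have "\<alpha> * t \<le> \<bar>\<alpha>\<bar> * t" using t by (intro mult_right_mono) auto
    ultimately have "f z + q z \<ge> f x + t + (- L * norm (w z) + K * (norm (w z))\<^sup>2)"
      using fz Lz by (simp add: q_def st)
    then show False using pen[of "norm (w z)"] small zlow m by linarith
  qed
  moreover have "norm (w z) \<noteq> t"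
  proof
    assume wt: "norm (w z) = t"
    have "K * t > 2 * L + \<bar>\<alpha>\<bar>" using K(3) t by (simp add: field_simps)
    then have "K * t * t > (2 * L + \<bar>\<alpha>\<bar>) * t" using t by (intro mult_strict_right_mono) auto
    then have "K * t\<^sup>2 > 2 * (L * t) + \<bar>\<alpha>\<bar> * t" by (simp add: power2_eq_square algebra_simps)
    moreover have "\<alpha> * s z \<le> \<bar>\<alpha>\<bar> * t" using zC by (intro mult_mono) auto
    moreover have "L * s z \<le> L * t" using zC L by (intro mult_left_mono) auto
    moreover have "A * (s z)\<^sup>2 \<ge> 0" using A by simp
    ultimately have "f z + q z \<ge> f x" using fz Lz by (simp add: q_def wt)
    then show False using zlow m by linarith
  qed
  ultimately have "z \<in> I" using zC by (auto simp: I_def)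
  then have loc: "\<forall>\<^sub>F y in nhds z. y \<in> I" using \<open>open I\<close> by (simp add: eventually_nhds_in_open)
  \<comment> \<open>This is minus the gradient of \<open>q\<close> at \<open>z\<close>, the
    subgradient that stationarity of \<open>f + q\<close> predicts.\<close>
  define \<xi> where "\<xi> = (\<alpha> - 2 * A * s z) *\<^sub>R v - (2 * K) *\<^sub>R w z"
  have vw: "v \<bullet> w y = 0" for y by (simp add: w_def s_def inner_diff_right vv)
  \<comment> \<open>The Taylor expansion of the quadratic \<open>q\<close> is exact. Its
    second-order part splits along \<open>v\<close> and its orthogonal complement, and Pythagoras
    bounds it.\<close>
  have exp: "q y \<le> q z - \<xi> \<bullet> (y - z) + (A + K) * (norm (y - z))\<^sup>2" for y
  proof -
    define h where "h = y - z"
    define a where "a = v \<bullet> h"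
    define p where "p = h - a *\<^sub>R v"
    have sy: "s y = s z + a" by (simp add: s_def a_def h_def inner_diff_right)
    have wy: "w y = w z + p" unfolding w_def p_def sy by (simp add: h_def algebra_simps)
    have "(norm (w y))\<^sup>2 = (norm (w z))\<^sup>2 + 2 * (w z \<bullet> p) + (norm p)\<^sup>2"
      unfolding wy power2_norm_eq_inner by (simp add: inner_add inner_commute)
    moreover have wp: "w z \<bullet> p = w z \<bullet> h"
      using vw[of z] by (simp add: p_def inner_diff_right inner_commute)
    moreover have hh: "(norm h)\<^sup>2 = a\<^sup>2 + (norm p)\<^sup>2"
      unfolding power2_norm_eq_inner p_def
      by (simp add: inner_diff inner_commute vv a_def power2_eq_square)
    moreover have "\<xi> \<bullet> h = (\<alpha> - 2 * A * s z) * a - 2 * K * (w z \<bullet> h)"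
      by (simp add: \<xi>_def inner_diff_left a_def)
    ultimately have "q y = q z - \<xi> \<bullet> h + A * a\<^sup>2 + K * (norm p)\<^sup>2"
      unfolding q_def sy by (simp add: power2_eq_square algebra_simps)
    also have "\<dots> \<le> q z - \<xi> \<bullet> h + (A + K) * (norm h)\<^sup>2"
      using A(1) K(4) by (simp add: hh algebra_simps)
    finally show ?thesis by (simp add: h_def)
  qed
  have "\<xi> \<in> regular_subdiff f z"
  proof (rule regular_subdiffI_quadratic[where c = "A + K"])
    show "\<forall>\<^sub>F y in nhds z. f z + \<xi> \<bullet> (y - z) - (A + K) * (norm (y - z))\<^sup>2 \<le> f y"
      using loc
    proof eventually_elim
      case (elim y)
      then show ?case using z(2)[of y] exp[of y] \<open>I \<subseteq> C\<close> by auto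
    qed
  qed
  moreover have "v \<bullet> \<xi> \<le> \<alpha>"
    using A zC by (simp add: \<xi>_def inner_diff_right vv vw)
  moreover have "z \<in> ball x r" using z(1) Cball by auto
  ultimately show ?thesis by blast
qed


section \<open>Open truncated cones around a direction\<close>

text \<open>Parametrised by step and direction, as are the sequences in the directional limits,
  which therefore enter it eventually. Each slice with fixed \<open>t\<close> is an open ball, so
  the cone is open; for \<open>u = 0\<close> and \<open>\<epsilon> > 0\<close> it is the ball of
  radius \<open>\<epsilon>\<^sup>2\<close> around \<open>xb\<close>.\<close>

definition dir_cone :: "real \<Rightarrow> 'a::real_normed_vector \<Rightarrow> 'a \<Rightarrow> 'a set" where
  "dir_cone \<epsilon> xb u = (\<Union>t\<in>{0<..<\<epsilon>}. (\<lambda>d. xb + t *\<^sub>R d) ` ball u \<epsilon>)"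

lemma mem_dir_cone:
  "x \<in> dir_cone \<epsilon> xb u \<longleftrightarrow> (\<exists>t d. 0 < t \<and> t < \<epsilon> \<and> dist d u < \<epsilon> \<and> x = xb + t *\<^sub>R d)"
  by (fastforce simp: dir_cone_def dist_commute)

lemma open_dir_cone: "open (dir_cone \<epsilon> xb u)"
proof -
  have "open ((\<lambda>d. xb + t *\<^sub>R d) ` ball u \<epsilon>)" if "t > 0" for t
    using open_translation[OF open_scaling[of t "ball u \<epsilon>"], of xb] that
    by (simp add: image_image)
  then show ?thesis unfolding dir_cone_def by auto
qed

lemma dir_cone_mono: "\<epsilon> \<le> \<epsilon>' \<Longrightarrow> dir_cone \<epsilon> xb u \<subseteq> dir_cone \<epsilon>' xb u"
  unfolding mem_dir_cone subset_iff by force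

lemma eventually_in_dir_cone:
  assumes "\<And>k. t k > 0" "t \<longlonglongrightarrow> 0" "d \<longlonglongrightarrow> u" "\<epsilon> > 0"
  shows "\<forall>\<^sub>F k in sequentially. xb + t k *\<^sub>R d k \<in> dir_cone \<epsilon> xb u"
  using order_tendstoD(2)[OF assms(2,4)] tendstoD[OF assms(3,4)]
  by eventually_elim (use assms(1) in \<open>auto simp: mem_dir_cone\<close>)

text \<open>The angular condition in \<open>dir_nbhd\<close> is invariant under positive scaling, so
  it suffices to check it for directions \<open>d\<close> near \<open>u\<close>. Including
  \<open>xb\<close> makes \<open>\<phi>\<close> continuous at \<open>xb\<close> along the
  cone.\<close>

lemma dir_lipschitz_at_imp_lipschitz_on_dir_cone:
  assumes "dir_lipschitz_at \<phi> xb u"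
  shows "\<exists>L. \<exists>\<epsilon>>0. L-lipschitz_on (insert xb (dir_cone \<epsilon> xb u)) \<phi>"
proof -
  obtain L e \<delta> where L: "L > 0" "e > 0" "\<delta> > 0"
    and lip: "\<And>z z'. z \<in> dir_nbhd e \<delta> u \<Longrightarrow> z' \<in> dir_nbhd e \<delta> u \<Longrightarrow>
      \<bar>\<phi> (xb + z) - \<phi> (xb + z')\<bar> \<le> L * norm (z - z')"
    using assms unfolding dir_lipschitz_at_def by fastforce
  obtain \<eta> where \<eta>: "\<eta> > 0"
    "\<And>d. dist d u < \<eta> \<Longrightarrow> norm (norm u *\<^sub>R d - norm d *\<^sub>R u) \<le> \<delta> * norm d * norm u"
  proof (cases "u = 0")
    case True
    then show ?thesis by (intro that[of 1]) auto
  next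
    case False
    \<comment> \<open>At \<open>d = u\<close> the difference is
      \<open>\<delta> * norm u * norm u > 0\<close>, so by continuity it stays positive
      nearby.\<close>
    have "((\<lambda>d. \<delta> * norm d * norm u - norm (norm u *\<^sub>R d - norm d *\<^sub>R u)) \<longlongrightarrow>
        \<delta> * norm u * norm u - norm (norm u *\<^sub>R u - norm u *\<^sub>R u)) (nhds u)"
      by (intro tendsto_intros filterlim_ident)
    then have "\<forall>\<^sub>F d in nhds u. 0 < \<delta> * norm d * norm u - norm (norm u *\<^sub>R d - norm d *\<^sub>R u)"
      by (rule order_tendstoD) (use L False in auto)
    then show ?thesis using that unfolding eventually_nhds_metric by fastforce
  qed
  \<comment> \<open>The bound 1 gives \<open>norm d \<le> norm u + 1\<close>, and the quotient then
    gives \<open>norm (t *\<^sub>R d) < e\<close>.\<close>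
  define \<epsilon> where "\<epsilon> = min (min 1 \<eta>) (e / (norm u + 1))"
  have nu: "norm u + 1 > 0" using norm_ge_zero[of u] by linarith
  have \<epsilon>: "\<epsilon> > 0" "\<epsilon> \<le> 1" "\<epsilon> \<le> \<eta>" "\<epsilon> * (norm u + 1) \<le> e"
    using \<eta>(1) L(2) nu by (auto simp: \<epsilon>_def simp flip: pos_le_divide_eq)
  have sub: "t *\<^sub>R d \<in> dir_nbhd e \<delta> u" if "0 < t" "t < \<epsilon>" "dist d u < \<epsilon>" for t d
  proof -
    have "norm d \<le> norm u + 1"
      using that(3) \<epsilon>(2) norm_triangle_ineq2[of d u] by (simp add: dist_norm)
    then have "t * norm d \<le> t * (norm u + 1)" using that by simp
    also have "\<dots> < \<epsilon> * (norm u + 1)" using that nu by simp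
    finally have "norm (t *\<^sub>R d) < e" using \<epsilon>(4) that by simp
    moreover have "norm u *\<^sub>R t *\<^sub>R d - norm (t *\<^sub>R d) *\<^sub>R u = t *\<^sub>R (norm u *\<^sub>R d - norm d *\<^sub>R u)"
      using that by (simp add: algebra_simps)
    moreover have "t * norm (norm u *\<^sub>R d - norm d *\<^sub>R u) \<le> t * (\<delta> * norm d * norm u)"
      using \<eta>(2)[of d] that \<epsilon>(3) by (intro mult_left_mono) auto
    ultimately show ?thesis using that by (simp add: dir_nbhd_def mult_ac)
  qed
  have "L-lipschitz_on (insert xb (dir_cone \<epsilon> xb u)) \<phi>"
  proof (rule lipschitz_onI)
    have nb: "x - xb \<in> dir_nbhd e \<delta> u" if "x \<in> insert xb (dir_cone \<epsilon> xb u)" for x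
      using that sub L(2) by (auto simp: mem_dir_cone) (simp add: dir_nbhd_def)
    fix x y assume "x \<in> insert xb (dir_cone \<epsilon> xb u)" "y \<in> insert xb (dir_cone \<epsilon> xb u)"
    from lip[OF nb[OF this(1)] nb[OF this(2)]] show "dist (\<phi> x) (\<phi> y) \<le> L * dist x y"
      by (simp add: dist_norm)
  qed (use L in simp)
  then show ?thesis using \<epsilon>(1) by blast
qed

section \<open>Compactness of the directional limiting subdifferential, and separation\<close>

text \<open>A diagonal choice turns membership in all closures into one sequence; the required
  convergence of the values of \<open>\<phi>\<close> follows from continuity at \<open>xb\<close>
  along the cone. In this form closedness is immediate, and nested compact sets can be used.\<close>

lemma dir_limiting_subdiff_eq_INT_closure:
  assumes lip: "L-lipschitz_on (insert xb (dir_cone \<epsilon>0 xb u)) \<phi>" and "\<epsilon>0 > 0"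
  shows "dir_limiting_subdiff \<phi> xb u =
    (\<Inter>\<epsilon>\<in>{0<..}. closure (\<Union>x\<in>dir_cone \<epsilon> xb u. regular_subdiff \<phi> x))"
proof (intro equalityI subsetI INT_I)
  fix \<xi> and \<epsilon> :: real assume "\<xi> \<in> dir_limiting_subdiff \<phi> xb u" and "\<epsilon> \<in> {0<..}"
  then obtain t d \<zeta> where t: "\<And>k. t k > (0::real)" "t \<longlonglongrightarrow> 0" "d \<longlonglongrightarrow> u" and "\<zeta> \<longlonglongrightarrow> \<xi>"
    and sub: "\<And>k. \<zeta> k \<in> regular_subdiff \<phi> (xb + t k *\<^sub>R d k)" and "\<epsilon> > 0"
    by (auto simp: dir_limiting_subdiff_def)
  have "\<forall>\<^sub>F k in sequentially. \<zeta> k \<in> closure (\<Union>x\<in>dir_cone \<epsilon> xb u. regular_subdiff \<phi> x)"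
    using eventually_in_dir_cone[OF t \<open>\<epsilon> > 0\<close>, of xb]
    by eventually_elim (use sub closure_subset in blast)
  then show "\<xi> \<in> closure (\<Union>x\<in>dir_cone \<epsilon> xb u. regular_subdiff \<phi> x)"
    by (rule Lim_in_closed_set[OF closed_closure _ _ \<open>\<zeta> \<longlonglongrightarrow> \<xi>\<close>]) simp
next
  fix \<xi> assume \<xi>: "\<xi> \<in> (\<Inter>\<epsilon>\<in>{0<..}. closure (\<Union>x\<in>dir_cone \<epsilon> xb u. regular_subdiff \<phi> x))"
  \<comment> \<open>The cap \<open>\<epsilon>0\<close> keeps every term of the sequence where
    \<open>\<phi>\<close> is known to be Lipschitz.\<close>
  define e where "e k = min \<epsilon>0 (inverse (real (Suc k)))" for k
  have e: "e k > 0" "e k \<le> \<epsilon>0" for k using \<open>\<epsilon>0 > 0\<close> by (auto simp: e_def)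
  have "\<exists>t d \<zeta>. 0 < t \<and> t < e k \<and> dist d u < e k \<and> dist \<zeta> \<xi> < e k \<and>
      \<zeta> \<in> regular_subdiff \<phi> (xb + t *\<^sub>R d)" for k
  proof -
    have "\<xi> \<in> closure (\<Union>x\<in>dir_cone (e k) xb u. regular_subdiff \<phi> x)" using \<xi> e by auto
    then show ?thesis unfolding closure_approachable using e(1)[of k] by (fastforce simp: mem_dir_cone)
  qed
  then obtain t d \<zeta> where k: "\<And>k. 0 < t k" "\<And>k. t k < e k" "\<And>k. dist (d k) u < e k"
    "\<And>k. dist (\<zeta> k) \<xi> < e k" "\<And>k. \<zeta> k \<in> regular_subdiff \<phi> (xb + t k *\<^sub>R d k)"
    by metis
  have conv: "f \<longlonglongrightarrow> l" if "\<And>k. dist (f k) l < e k" for f and l :: "'c::metric_space"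
  proof (rule metric_tendsto_imp_tendsto[OF LIMSEQ_inverse_real_of_nat])
    have "dist (f k) l \<le> dist (inverse (real (Suc k))) 0" for k
      using that[of k] by (simp add: e_def)
    then show "\<forall>\<^sub>F k in sequentially. dist (f k) l \<le> dist (inverse (real (Suc k))) 0" by simp
  qed
  have lims: "t \<longlonglongrightarrow> 0" "d \<longlonglongrightarrow> u" "\<zeta> \<longlonglongrightarrow> \<xi>"
    using k(1-4) by (auto intro!: conv simp: dist_real_def abs_of_pos)
  have "(\<lambda>k. xb + t k *\<^sub>R d k) \<longlonglongrightarrow> xb + 0 *\<^sub>R u" by (intro tendsto_intros lims)
  then have "(\<lambda>k. xb + t k *\<^sub>R d k) \<longlonglongrightarrow> xb" by simp
  moreover have "xb + t k *\<^sub>R d k \<in> dir_cone \<epsilon>0 xb u" for k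
    using k(1-3)[of k] e(2)[of k] by (auto simp: mem_dir_cone intro!: exI[of _ "t k"] exI[of _ "d k"])
  ultimately have "(\<lambda>k. \<phi> (xb + t k *\<^sub>R d k)) \<longlonglongrightarrow> \<phi> xb"
    by (intro continuous_on_tendsto_compose[OF lipschitz_on_continuous_on[OF lip]]) auto
  then show "\<xi> \<in> dir_limiting_subdiff \<phi> xb u"
    unfolding dir_limiting_subdiff_def using k lims by blast
qed

lemma bounded_regular_subdiff_dir_cone:
  assumes "L-lipschitz_on (insert xb (dir_cone \<epsilon> xb u)) \<phi>"
  shows "bounded (\<Union>x\<in>dir_cone \<epsilon> xb u. regular_subdiff \<phi> x)"
proof (rule boundedI)
  fix \<xi> assume "\<xi> \<in> (\<Union>x\<in>dir_cone \<epsilon> xb u. regular_subdiff \<phi> x)"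
  then show "norm \<xi> \<le> L"
    using norm_regular_subdiff_le[OF _ lipschitz_on_subset[OF assms] open_dir_cone] by blast
qed

lemma compact_dir_limiting_subdiff:
  fixes \<phi> :: "'a::euclidean_space \<Rightarrow> real"
  assumes lip: "L-lipschitz_on (insert xb (dir_cone \<epsilon> xb u)) \<phi>" and "\<epsilon> > 0"
  shows "compact (dir_limiting_subdiff \<phi> xb u)"
proof -
  have "dir_limiting_subdiff \<phi> xb u \<subseteq> closure (\<Union>x\<in>dir_cone \<epsilon> xb u. regular_subdiff \<phi> x)"
    unfolding dir_limiting_subdiff_eq_INT_closure[OF assms] using \<open>\<epsilon> > 0\<close> by auto
  then have "bounded (dir_limiting_subdiff \<phi> xb u)"
    using bounded_closure[OF bounded_regular_subdiff_dir_cone[OF lip]] bounded_subset by blast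
  moreover have "closed (dir_limiting_subdiff \<phi> xb u)"
    unfolding dir_limiting_subdiff_eq_INT_closure[OF assms] by (intro closed_INT) auto
  ultimately show ?thesis by (simp add: compact_eq_bounded_closed)
qed

text \<open>Strict separation from the compact hull leaves a gap. If the inequality failed on
  arbitrarily small cones, the offending subgradients would accumulate at a point of the limiting
  subdifferential on the wrong side of the hyperplane.\<close>

lemma separate_from_dir_clarke_subdiff:
  fixes \<phi> :: "'a::euclidean_space \<Rightarrow> real"
  assumes lip: "L-lipschitz_on (insert xb (dir_cone \<epsilon>0 xb u)) \<phi>" and "\<epsilon>0 > 0"
    and "\<eta> \<notin> dir_clarke_subdiff \<phi> xb u"
  shows "\<exists>a b \<epsilon>. a \<noteq> 0 \<and> 0 < \<epsilon> \<and> \<epsilon> \<le> \<epsilon>0 \<and> a \<bullet> \<eta> < b \<and>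
    (\<forall>x\<in>dir_cone \<epsilon> xb u. \<forall>\<xi>\<in>regular_subdiff \<phi> x. b < a \<bullet> \<xi>)"
proof -
  define C where "C = dir_clarke_subdiff \<phi> xb u"
  define R where "R \<epsilon> = (\<Union>x\<in>dir_cone \<epsilon> xb u. regular_subdiff \<phi> x)" for \<epsilon>
  have "compact C" "convex C"
    unfolding C_def dir_clarke_subdiff_def
    using compact_convex_hull[OF compact_dir_limiting_subdiff[OF assms(1,2)]] by auto
  then have "convex ((\<lambda>\<xi>. \<xi> - \<eta>) ` C)" "closed ((\<lambda>\<xi>. \<xi> - \<eta>) ` C)" "0 \<notin> (\<lambda>\<xi>. \<xi> - \<eta>) ` C"
    using assms(3) by (auto simp: closed_translation_subtract compact_imp_closed C_def)
  then obtain a b where ab: "a \<noteq> 0" "0 < b" "\<And>\<xi>. \<xi> \<in> C \<Longrightarrow> a \<bullet> (\<xi> - \<eta>) > b"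
    using separating_hyperplane_closed_0 by (metis image_eqI)
  define e where "e n = \<epsilon>0 * inverse (real (Suc n))" for n
  have e: "e n > 0" "e n \<le> \<epsilon>0" for n
    using \<open>\<epsilon>0 > 0\<close> by (auto simp: e_def field_simps)
  have "\<exists>n. \<forall>\<xi>\<in>R (e n). a \<bullet> \<eta> + b < a \<bullet> \<xi>"
  proof (rule ccontr)
    assume neg: "\<not> (\<exists>n. \<forall>\<xi>\<in>R (e n). a \<bullet> \<eta> + b < a \<bullet> \<xi>)"
    \<comment> \<open>Closures of subgradient sets cut by the closed opposite half-space: compact,
      decreasing and, under the negated claim, nonempty.\<close>
    define F where "F n = closure (R (e n)) \<inter> {\<xi>. a \<bullet> \<xi> \<le> a \<bullet> \<eta> + b}" for n
    have mono: "R \<epsilon> \<subseteq> R \<epsilon>'" if "\<epsilon> \<le> \<epsilon>'" for \<epsilon> \<epsilon>'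
      using dir_cone_mono[OF that, of xb u] by (auto simp: R_def)
    have "bounded (closure (R (e n)))" for n
      using bounded_regular_subdiff_dir_cone[OF lip] mono[OF e(2), of n] bounded_subset
      by (auto simp: R_def intro!: bounded_closure)
    then have "compact (F n)" for n
      unfolding F_def by (intro compact_Int_closed closed_halfspace_le)
        (simp add: compact_eq_bounded_closed)
    moreover have "F n \<noteq> {}" for n
    proof -
      obtain \<xi> where "\<xi> \<in> R (e n)" "\<not> a \<bullet> \<eta> + b < a \<bullet> \<xi>" using neg by blast
      then have "\<xi> \<in> F n" using closure_subset by (force simp: F_def)
      then show ?thesis by blast
    qed
    moreover have "F n \<subseteq> F m" if "m \<le> n" for m n
    proof -
      have "e n \<le> e m"
        unfolding e_def using that \<open>\<epsilon>0 > 0\<close> by (intro mult_left_mono le_imp_inverse_le) auto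
      from closure_mono[OF mono[OF this]] show ?thesis by (auto simp: F_def)
    qed
    ultimately have "\<Inter> (range F) \<noteq> {}" by (intro compact_nest)
    then obtain \<xi> where \<xi>: "\<And>n. \<xi> \<in> F n" by auto
    have "\<xi> \<in> closure (R \<epsilon>)" if "\<epsilon> > 0" for \<epsilon>
    proof -
      have "\<epsilon> / \<epsilon>0 > 0" using that \<open>\<epsilon>0 > 0\<close> by simp
      then obtain n where "inverse (real (Suc n)) < \<epsilon> / \<epsilon>0"
        using reals_Archimedean by blast
      then have "e n \<le> \<epsilon>" using \<open>\<epsilon>0 > 0\<close> by (simp add: e_def field_simps)
      from closure_mono[OF mono[OF this]] show ?thesis using \<xi>[of n] by (auto simp: F_def)
    qed
    then have "\<xi> \<in> C"
      unfolding C_def dir_clarke_subdiff_def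
      by (intro hull_inc) (simp add: dir_limiting_subdiff_eq_INT_closure[OF assms(1,2)] R_def)
    then show False using ab(3) \<xi>[of 0] by (fastforce simp: F_def inner_diff_right)
  qed
  then obtain n where "\<forall>\<xi>\<in>R (e n). a \<bullet> \<eta> + b < a \<bullet> \<xi>" ..
  then show ?thesis
    using ab e(1,2)[of n]
    by (intro exI[of _ a] exI[of _ "a \<bullet> \<eta> + b"] exI[of _ "e n"]) (auto simp: R_def)
qed

section \<open>The formula with the outer limit\<close>

lemma dir_limiting_subdiff_subset_dir_limsup:
  "dir_limiting_subdiff \<phi> xb u \<subseteq> dir_limsup (clarke_subdiff \<phi>) xb u"
proof -
  have "regular_subdiff \<phi> x \<subseteq> clarke_subdiff \<phi> x" for x
  proof
    fix \<xi> assume "\<xi> \<in> regular_subdiff \<phi> x"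
    then have "\<xi> \<in> dir_limiting_subdiff \<phi> x 0"
      unfolding dir_limiting_subdiff_def
      \<comment> \<open>The constant direction 0 keeps the whole sequence at \<open>x\<close>, so
        all the limits but that of the steps are limits of constants.\<close>
      by (intro CollectI exI[of _ "\<lambda>k. inverse (real (Suc k))"] exI[of _ "\<lambda>_. 0"] exI[of _ "\<lambda>_. \<xi>"])
        (use LIMSEQ_inverse_real_of_nat in auto)
    then show "\<xi> \<in> clarke_subdiff \<phi> x"
      unfolding clarke_subdiff_def dir_clarke_subdiff_def by (rule hull_inc)
  qed
  then show ?thesis unfolding dir_limiting_subdiff_def dir_limsup_def by blast
qed

text \<open>A closed half-space is stable under limits and convex hulls, and sequences tending to
  \<open>x\<close> eventually lie in the open set \<open>U\<close>.\<close>

lemma clarke_subdiff_half_space: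
  assumes "open U" "x \<in> U" "\<And>z \<xi>. z \<in> U \<Longrightarrow> \<xi> \<in> regular_subdiff \<phi> z \<Longrightarrow> b \<le> a \<bullet> \<xi>"
    and "\<eta> \<in> clarke_subdiff \<phi> x"
  shows "b \<le> a \<bullet> \<eta>"
proof -
  have "dir_limiting_subdiff \<phi> x 0 \<subseteq> {\<xi>. b \<le> a \<bullet> \<xi>}"
  proof
    fix \<xi> assume "\<xi> \<in> dir_limiting_subdiff \<phi> x 0"
    then obtain t d \<zeta> where t: "t \<longlonglongrightarrow> (0::real)" "d \<longlonglongrightarrow> 0" "\<zeta> \<longlonglongrightarrow> \<xi>"
      and sub: "\<And>k. \<zeta> k \<in> regular_subdiff \<phi> (x + t k *\<^sub>R d k)"
      by (auto simp: dir_limiting_subdiff_def)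
    have "(\<lambda>k. x + t k *\<^sub>R d k) \<longlonglongrightarrow> x + 0 *\<^sub>R 0" by (intro tendsto_intros t)
    then have "\<forall>\<^sub>F k in sequentially. x + t k *\<^sub>R d k \<in> U"
      using assms(1,2) by (intro topological_tendstoD) auto
    then have "\<forall>\<^sub>F k in sequentially. b \<le> a \<bullet> \<zeta> k"
      by eventually_elim (use assms(3) sub in blast)
    moreover have "(\<lambda>k. a \<bullet> \<zeta> k) \<longlonglongrightarrow> a \<bullet> \<xi>" by (intro tendsto_intros t)
    ultimately show "\<xi> \<in> {\<xi>. b \<le> a \<bullet> \<xi>}"
      using tendsto_lowerbound[of _ _ sequentially b] by auto
  qed
  then have "clarke_subdiff \<phi> x \<subseteq> {\<xi>. b \<le> a \<bullet> \<xi>}"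
    unfolding clarke_subdiff_def dir_clarke_subdiff_def
    by (intro hull_minimal convex_halfspace_ge)
  then show ?thesis using assms(4) by blast
qed

text \<open>The separating cone is open, hence a neighbourhood of each of its points. The bound by
  \<open>b\<close> thus passes to Clarke subgradients there and then to their limit
  \<open>\<eta>\<close>, against \<open>a \<bullet> \<eta> < b\<close>.\<close>

lemma dir_limsup_clarke_subdiff_subset:
  fixes \<phi> :: "'a::euclidean_space \<Rightarrow> real"
  assumes "dir_lipschitz_at \<phi> xb u"
  shows "dir_limsup (clarke_subdiff \<phi>) xb u \<subseteq> dir_clarke_subdiff \<phi> xb u"
proof (rule subsetI, rule ccontr)
  fix \<eta> assume \<eta>: "\<eta> \<in> dir_limsup (clarke_subdiff \<phi>) xb u" "\<eta> \<notin> dir_clarke_subdiff \<phi> xb u"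
  obtain a b \<epsilon> where ab: "\<epsilon> > 0" "a \<bullet> \<eta> < b"
    "\<And>x \<xi>. x \<in> dir_cone \<epsilon> xb u \<Longrightarrow> \<xi> \<in> regular_subdiff \<phi> x \<Longrightarrow> b \<le> a \<bullet> \<xi>"
    using dir_lipschitz_at_imp_lipschitz_on_dir_cone[OF assms]
      separate_from_dir_clarke_subdiff[OF _ _ \<eta>(2)] by (meson less_imp_le)
  obtain t d \<zeta> where t: "\<And>k. t k > (0::real)" "t \<longlonglongrightarrow> 0" "d \<longlonglongrightarrow> u" and "\<zeta> \<longlonglongrightarrow> \<eta>"
    and sub: "\<And>k. \<zeta> k \<in> clarke_subdiff \<phi> (xb + t k *\<^sub>R d k)"
    using \<eta>(1) by (auto simp: dir_limsup_def)
  have "\<forall>\<^sub>F k in sequentially. b \<le> a \<bullet> \<zeta> k"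
    using eventually_in_dir_cone[OF t ab(1), of xb]
    by eventually_elim (rule clarke_subdiff_half_space[OF open_dir_cone _ ab(3) sub])
  moreover have "(\<lambda>k. a \<bullet> \<zeta> k) \<longlonglongrightarrow> a \<bullet> \<eta>" using \<open>\<zeta> \<longlonglongrightarrow> \<eta>\<close> by (intro tendsto_intros)
  ultimately have "b \<le> a \<bullet> \<eta>" using tendsto_lowerbound[of _ _ sequentially b] by auto
  then show False using ab(2) by simp
qed

section \<open>Symmetry under change of sign\<close>

text \<open>Rescaling to a unit vector divides the slope bound by \<open>norm a\<close> as
  well.\<close>

lemma regular_subdiff_below_slope:
  fixes f :: "'a::euclidean_space \<Rightarrow> real"
  assumes "L-lipschitz_on (ball x r) f" "r > 0" "- \<eta> \<in> regular_subdiff (\<lambda>y. - f y) x"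
    and "a \<noteq> 0" and "a \<bullet> \<eta> < b"
  shows "\<exists>z\<in>ball x r. \<exists>\<xi>\<in>regular_subdiff f z. a \<bullet> \<xi> \<le> b"
proof -
  have "norm (a /\<^sub>R norm a) = 1" "(a /\<^sub>R norm a) \<bullet> \<eta> < b / norm a"
    using assms(4,5) by (auto simp: divide_simps)
  from regular_subdiff_below_slope_unit[OF assms(1-3) this] show ?thesis
    using assms(4) by (simp add: divide_simps)
qed

lemma uminus_dir_limiting_subdiff_uminus_mem:
  fixes \<phi> :: "'a::euclidean_space \<Rightarrow> real"
  assumes "dir_lipschitz_at \<phi> xb u" and \<zeta>: "\<zeta> \<in> dir_limiting_subdiff (\<lambda>x. - \<phi> x) xb u"
  shows "- \<zeta> \<in> dir_clarke_subdiff \<phi> xb u"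
proof (rule ccontr)
  assume notin: "- \<zeta> \<notin> dir_clarke_subdiff \<phi> xb u"
  obtain L \<epsilon>0 where lip: "\<epsilon>0 > 0" "L-lipschitz_on (insert xb (dir_cone \<epsilon>0 xb u)) \<phi>"
    using dir_lipschitz_at_imp_lipschitz_on_dir_cone[OF assms(1)] by blast
  obtain a b \<epsilon> where ab: "a \<noteq> 0" "\<epsilon> > 0" "\<epsilon> \<le> \<epsilon>0" "a \<bullet> - \<zeta> < b"
    "\<And>x \<xi>. x \<in> dir_cone \<epsilon> xb u \<Longrightarrow> \<xi> \<in> regular_subdiff \<phi> x \<Longrightarrow> b < a \<bullet> \<xi>"
    using separate_from_dir_clarke_subdiff[OF lip(2,1) notin] by blast
  obtain t d \<zeta>' where t: "\<And>k. t k > (0::real)" "t \<longlonglongrightarrow> 0" "d \<longlonglongrightarrow> u" and "\<zeta>' \<longlonglongrightarrow> \<zeta>"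
    and sub: "\<And>k. \<zeta>' k \<in> regular_subdiff (\<lambda>x. - \<phi> x) (xb + t k *\<^sub>R d k)"
    using \<zeta> by (auto simp: dir_limiting_subdiff_def)
  have "(\<lambda>k. a \<bullet> - \<zeta>' k) \<longlonglongrightarrow> a \<bullet> - \<zeta>" using \<open>\<zeta>' \<longlonglongrightarrow> \<zeta>\<close> by (intro tendsto_intros)
  then have "\<forall>\<^sub>F k in sequentially. a \<bullet> - \<zeta>' k < b" using ab(4) by (rule order_tendstoD)
  with eventually_in_dir_cone[OF t ab(2), of xb]
  have "\<forall>\<^sub>F k in sequentially. xb + t k *\<^sub>R d k \<in> dir_cone \<epsilon> xb u \<and> a \<bullet> - \<zeta>' k < b"
    by eventually_elim simp
  \<comment> \<open>One such index suffices: a ball around this point inside the cone contains a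
    point with a regular subgradient \<open>\<xi>\<close> satisfying
    \<open>a \<bullet> \<xi> \<le> b\<close>, against the strict separation.\<close>
  then obtain k where k: "xb + t k *\<^sub>R d k \<in> dir_cone \<epsilon> xb u" "a \<bullet> - \<zeta>' k < b"
    using eventually_happens'[OF sequentially_bot] by blast
  obtain r where r: "r > 0" "ball (xb + t k *\<^sub>R d k) r \<subseteq> dir_cone \<epsilon> xb u"
    using open_dir_cone k(1) open_contains_ball by blast
  have "L-lipschitz_on (ball (xb + t k *\<^sub>R d k) r) \<phi>"
    by (rule lipschitz_on_subset[OF lip(2)]) (use r(2) dir_cone_mono[OF ab(3), of xb u] in blast)
  from regular_subdiff_below_slope[OF this r(1) _ ab(1) k(2)]
  obtain z \<xi> where "z \<in> ball (xb + t k *\<^sub>R d k) r" "\<xi> \<in> regular_subdiff \<phi> z" "a \<bullet> \<xi> \<le> b"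
    using sub[of k] by auto
  then show False using ab(5)[of z \<xi>] r(2) by auto
qed

lemma dir_clarke_subdiff_uminus_subset:
  fixes \<phi> :: "'a::euclidean_space \<Rightarrow> real"
  assumes "dir_lipschitz_at \<phi> xb u"
  shows "dir_clarke_subdiff (\<lambda>x. - \<phi> x) xb u \<subseteq> uminus ` dir_clarke_subdiff \<phi> xb u"
  unfolding dir_clarke_subdiff_def[of "\<lambda>x. - \<phi> x"]
proof (rule hull_minimal)
  show "dir_limiting_subdiff (\<lambda>x. - \<phi> x) xb u \<subseteq> uminus ` dir_clarke_subdiff \<phi> xb u"
    using uminus_dir_limiting_subdiff_uminus_mem[OF assms]
    by (intro subsetI image_eqI[where f = uminus, OF minus_minus[symmetric]])
  show "convex (uminus ` dir_clarke_subdiff \<phi> xb u)"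
    by (intro convex_negations) (simp add: dir_clarke_subdiff_def)
qed

theorem proposition2p1:
  fixes \<phi> :: "real ^ 'n \<Rightarrow> real" and xb u :: "real ^ 'n"
  assumes "dir_lipschitz_at \<phi> xb u"
  shows "dir_clarke_subdiff \<phi> xb u = convex hull (dir_limsup (clarke_subdiff \<phi>) xb u) \<and>
         dir_clarke_subdiff (\<lambda>x. - \<phi> x) xb u = uminus ` dir_clarke_subdiff \<phi> xb u"
proof (intro conjI equalityI)
  show "dir_clarke_subdiff \<phi> xb u \<subseteq> convex hull (dir_limsup (clarke_subdiff \<phi>) xb u)"
    unfolding dir_clarke_subdiff_def
    by (intro hull_mono dir_limiting_subdiff_subset_dir_limsup)
  show "convex hull (dir_limsup (clarke_subdiff \<phi>) xb u) \<subseteq> dir_clarke_subdiff \<phi> xb u"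
    by (intro hull_minimal dir_limsup_clarke_subdiff_subset assms) (simp add: dir_clarke_subdiff_def)
  show "dir_clarke_subdiff (\<lambda>x. - \<phi> x) xb u \<subseteq> uminus ` dir_clarke_subdiff \<phi> xb u"
    by (rule dir_clarke_subdiff_uminus_subset[OF assms])
  \<comment> \<open>The reverse inclusion is the same inclusion applied to \<open>- \<phi>\<close>,
    as negating twice restores \<open>\<phi>\<close>.\<close>
  have "dir_lipschitz_at (\<lambda>x. - \<phi> x) xb u"
    using assms unfolding dir_lipschitz_at_def by (simp add: abs_minus_commute)
  from dir_clarke_subdiff_uminus_subset[OF this]
  show "uminus ` dir_clarke_subdiff \<phi> xb u \<subseteq> dir_clarke_subdiff (\<lambda>x. - \<phi> x) xb u"
    by auto
qed

end
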